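(* Let $f(x)$ be a polynomial with nonnegative integer coefficients and of degree at least two. Then for any infinite sequence $\mathcal{S}=\{s_i\}_{i=1}^{\infty}$ of positive integers and for any integer $n\ge 2$, the reciprocal power sum $$H_f(\mathcal{S}_n)=\sum_{k=1}^{n}\frac{1}{f(k)^{s_k}}$$ is not an integer.
   Context: The terms $s_i$ of the sequence $\mathcal{S}$ are not required to be distinct or monotonic. For $n\ge 1$, $\mathcal{S}_n:=\{s_1,\dots,s_n\}$ and $H_f(\mathcal{S}_n):=\sum_{k=1}^{n}\frac{1}{f(k)^{s_k}}$. *)

theory Defs
  imports Complex_Main "HOL-Computational_Algebra.Polynomial"
begin

text \<open>
  The sequence is indexed from 1; the value \<open>s 0\<close> is irrelevant.
\<close>

definition recip_power_sum :: "int poly \<Rightarrow> (nat \<Rightarrow> nat) \<Rightarrow> nat \<Rightarrow> real" where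
  "recip_power_sum f s n = (\<Sum>k=1..n. 1 / real_of_int (poly f (int k)) ^ s k)"

end

theory Submission
  imports "HOL-Number_Theory.Pocklington" "HOL-Number_Theory.Prime_Powers" Defs
begin

text \<open>
  If \<open>f(1) = 1\<close>, the sum lies strictly between 1 and 2; in all other cases except \<open>f = x\<^sup>2 + 1\<close>
  a telescoping comparison shows that it lies strictly between 0 and 1.

  For \<open>f = x\<^sup>2 + 1\<close> and \<open>n \<ge> 4\<close> there is a prime that divides \<open>k\<^sup>2 + 1\<close> for exactly one \<open>k \<le> n\<close>,
  and it divides the reduced denominator of the sum. If \<open>n\<close> is not too large, a suitable prime
  of the form \<open>k\<^sup>2 + 1\<close> does this for all \<open>n\<close> from \<open>k\<close> to \<open>k\<^sup>2 - k\<close>.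
  For large \<open>n\<close>, if no such prime exists, then all prime factors of the product of the \<open>k\<^sup>2 + 1\<close>
  with \<open>k \<le> n\<close> are at most \<open>2n\<close>. Let \<open>\<chi>\<close> be the nontrivial character modulo 4 and \<open>R(N)\<close> the sum of
  \<open>\<chi>(d)\<close> over all pairs with \<open>de \<le> N\<close>. A prime power \<open>q \<le> 2n\<close> divides at most
  \<open>(1 + \<chi>(q)) R(2n/q)\<close> of the numbers \<open>k\<^sup>2 + 1\<close>, and the sum of
  \<open>\<Lambda>(q) (1 + \<chi>(q)) R(2n/q)\<close> over all \<open>q\<close> equals the sum of \<open>\<chi>(d) ln(de)\<close> over the pairs with
  \<open>de \<le> 2n\<close>, which is at most \<open>R(2n) ln(2n)\<close>. Since \<open>R(N)\<close> is an alternating sum,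
  \<open>R(2n)\<close> is below \<open>1.65n\<close>. The prime powers above \<open>2n\<close> are mostly squares of primes
  congruent to 1 modulo 4 and contribute little, so the product would be smaller than \<open>(n!)\<^sup>2\<close>.
\<close>

section \<open>A weighted count over the hyperbola\<close>

definition chi4 :: "nat \<Rightarrow> int" where
  "chi4 d = (if d mod 4 = 1 then 1 else if d mod 4 = 3 then -1 else 0)"

lemma chi4_mult: "chi4 (a * b) = chi4 a * chi4 b"
proof -
  define x y where "x = a mod 4" and "y = b mod 4"
  have "x \<in> {0, 1, 2, 3}" "y \<in> {0, 1, 2, 3}" by (auto simp: x_def y_def)
  moreover have "a * b mod 4 = x * y mod 4" by (simp add: x_def y_def mod_mult_eq)
  ultimately show ?thesis unfolding chi4_def x_def [symmetric] y_def [symmetric] by auto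
qed

lemma chi4_power: "chi4 (a ^ j) = chi4 a ^ j"
  by (induction j) (simp_all add: chi4_mult, simp add: chi4_def)

lemma chi4_ge: "chi4 d \<ge> -1"
  by (simp add: chi4_def)

definition hyperbola_pairs :: "nat \<Rightarrow> (nat \<times> nat) set" where
  "hyperbola_pairs N = {(d, e). d \<ge> 1 \<and> e \<ge> 1 \<and> d * e \<le> N}"

lemma hyperbola_pairs_Sigma: "hyperbola_pairs N = Sigma {1..N} (\<lambda>d. {1..N div d})"
proof (intro equalityI subsetI; clarify)
  fix d e assume "(d, e) \<in> hyperbola_pairs N"
  hence *: "d \<ge> 1" "e \<ge> 1" "d * e \<le> N" by (auto simp: hyperbola_pairs_def)
  have "d \<le> d * e" using *(2) by simp
  hence "d \<le> N" using *(3) by linarith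
  moreover have "e \<le> N div d" using * by (simp add: less_eq_div_iff_mult_less_eq mult.commute)
  ultimately show "d \<in> {1..N} \<and> e \<in> {1..N div d}" using * by auto
next
  fix d e assume "d \<in> {1..N}" "e \<in> {1..N div d}"
  thus "(d, e) \<in> hyperbola_pairs N"
    by (auto simp: hyperbola_pairs_def less_eq_div_iff_mult_less_eq mult.commute)
qed

lemma finite_hyperbola_pairs [simp]: "finite (hyperbola_pairs N)"
  by (simp add: hyperbola_pairs_Sigma)

lemma hyperbola_pairs_swap: "hyperbola_pairs N = prod.swap ` hyperbola_pairs N"
  by (auto simp: hyperbola_pairs_def mult.commute image_iff)

text \<open>Self-similarity of the region under the hyperbola: sums restricted to multiples of
  \<open>q\<close> become sums for \<open>N div q\<close>.\<close>

lemma hyperbola_pairs_dvd: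
  assumes "q \<ge> 1"
  shows "{x \<in> hyperbola_pairs N. q dvd fst x} = (\<lambda>x. (q * fst x, snd x)) ` hyperbola_pairs (N div q)"
proof -
  have *: "q * d * e \<le> N \<longleftrightarrow> d * e \<le> N div q" for d e
    using assms by (simp add: less_eq_div_iff_mult_less_eq mult_ac)
  show ?thesis
  proof (intro equalityI subsetI)
    fix x assume "x \<in> {x \<in> hyperbola_pairs N. q dvd fst x}"
    then obtain d e where "x = (q * d, e)" "(q * d, e) \<in> hyperbola_pairs N"
      by (cases x) (auto elim: dvdE)
    moreover from this have "(d, e) \<in> hyperbola_pairs (N div q)"
      using * by (auto simp: hyperbola_pairs_def Suc_le_eq)
    ultimately show "x \<in> (\<lambda>x. (q * fst x, snd x)) ` hyperbola_pairs (N div q)"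
      by (intro image_eqI[of _ _ "(d, e)"]) auto
  qed (use assms * in \<open>auto simp: hyperbola_pairs_def Suc_le_eq\<close>)
qed

text \<open>The number of nonzero Gaussian integers of norm at most \<open>N\<close>, up to units.\<close>

definition gauss_count :: "nat \<Rightarrow> int" where
  "gauss_count N = (\<Sum>(d, e)\<in>hyperbola_pairs N. chi4 d)"

lemma gauss_count_eq_sum_div: "gauss_count N = (\<Sum>d=1..N. chi4 d * int (N div d))"
  by (simp add: gauss_count_def hyperbola_pairs_Sigma sum.Sigma [symmetric] mult.commute)

text \<open>Grouping \<open>d\<close> modulo 4 leaves nonnegative blocks, so dropping blocks gives
  lower bounds. Terms with \<open>d > N\<close> vanish, so any large enough \<open>T\<close>
  serves.\<close>

lemma gauss_count_eq_blocks:
  assumes "4 * T \<ge> N"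
  shows "gauss_count N = (\<Sum>t<T. int (N div (4*t+1)) - int (N div (4*t+3)))"
proof -
  have "gauss_count N = (\<Sum>d=1..4*T. chi4 d * int (N div d))"
    unfolding gauss_count_eq_sum_div using assms by (intro sum.mono_neutral_left) auto
  also have "\<dots> = (\<Sum>t<T. int (N div (4*t+1)) - int (N div (4*t+3)))"
  proof (induction T)
    case (Suc T)
    have [simp]: "chi4 (4*T+1) = 1" "chi4 (4*T+2) = 0" "chi4 (4*T+3) = -1" "chi4 (4*T+4) = 0"
      unfolding chi4_def by presburger+
    have "{1..4 * Suc T} = {1..4*T} \<union> {4*T+1, 4*T+2, 4*T+3, 4*T+4}" by auto
    hence "(\<Sum>d=1..4*Suc T. chi4 d * int (N div d)) = (\<Sum>d=1..4*T. chi4 d * int (N div d)) +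
             (\<Sum>d\<in>{4*T+1, 4*T+2, 4*T+3, 4*T+4}. chi4 d * int (N div d))"
      by (simp only:) (rule sum.union_disjoint, auto)
    also have "(\<Sum>d\<in>{4*T+1, 4*T+2, 4*T+3, 4*T+4}. chi4 d * int (N div d)) =
                 int (N div (4*T+1)) - int (N div (4*T+3))"
      by (simp del: add_Suc_right One_nat_def add_2_eq_Suc add_2_eq_Suc')
    finally show ?case using Suc.IH by simp
  qed simp
  finally show ?thesis .
qed

text \<open>Only the block \<open>t = 0\<close> is kept. This already dominates the number of roots
  in one residue class.\<close>

lemma gauss_count_ge: "gauss_count N \<ge> int (N - N div 3)"
proof (cases "N = 0")
  case False
  have "(\<Sum>t\<in>{0}. int (N div (4*t+1)) - int (N div (4*t+3))) \<le>
          (\<Sum>t<N. int (N div (4*t+1)) - int (N div (4*t+3)))"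
    using False by (intro sum_mono2) (auto intro!: div_le_mono2)
  thus ?thesis using gauss_count_eq_blocks[of N N] by (simp add: of_nat_diff)
qed (simp add: gauss_count_eq_sum_div)

lemma gauss_count_nonneg: "gauss_count N \<ge> 0"
  using gauss_count_ge[of N] by linarith

lemma gauss_count_le: "gauss_count N \<le> 36979 / 45045 * real N + 3"
proof -
  \<comment> \<open>the constant is \<open>1 - 1/3 + 1/5 - 1/7 + 1/9 - 1/11 + 1/13\<close>\<close>
  define T where "T = N + 3"
  \<comment> \<open>With the pairing shifted by one, the sum is \<open>N\<close> minus nonnegative
    blocks \<open>g t\<close>, up to a floor at the end; keeping three of them bounds it from
    above.\<close>
  define g where "g = (\<lambda>t. int (N div (4*t+3)) - int (N div (4*t+5)))"
  have "(\<Sum>t<T. int (N div (4*t+1)) - int (N div (4*t+3))) =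
          int N - int (N div (4*T+1)) - (\<Sum>t<T. g t)"
    by (induction T) (simp_all add: algebra_simps g_def)
  moreover have "(\<Sum>t\<in>{0,1,2}. g t) \<le> (\<Sum>t<T. g t)"
    by (intro sum_mono2) (auto intro!: div_le_mono2 simp: T_def g_def)
  ultimately have "gauss_count N \<le> int N - int (N div 3) + int (N div 5) - int (N div 7)
                     + int (N div 9) - int (N div 11) + int (N div 13)"
    using gauss_count_eq_blocks[of N T] by (simp add: T_def g_def)
  \<comment> \<open>Each of the three subtracted floors loses at most 1, whence the
    \<open>+ 3\<close>.\<close>
  moreover have "real (N div 3) \<ge> N / 3 - 1" "real (N div 7) \<ge> N / 7 - 1" "real (N div 11) \<ge> N / 11 - 1"
    "real (N div 5) \<le> N / 5" "real (N div 9) \<le> N / 9" "real (N div 13) \<le> N / 13"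
    by linarith+
  ultimately show ?thesis by linarith
qed

section \<open>The logarithmically weighted sum and the von Mangoldt function\<close>

definition gauss_log_sum :: "nat \<Rightarrow> real" where
  "gauss_log_sum N = (\<Sum>(d, e)\<in>hyperbola_pairs N. chi4 d * ln (real (d * e)))"

text \<open>Summation by parts, done as an induction: the new pairs all have product
  \<open>Suc N\<close>, hence a common logarithm, and because the earlier count is nonnegative its
  factor \<open>ln N\<close> may be raised to \<open>ln (Suc N)\<close>.\<close>

lemma gauss_log_sum_le: "gauss_log_sum N \<le> gauss_count N * ln (real N)"
proof (induction N)
  case 0
  show ?case by (simp add: gauss_log_sum_def hyperbola_pairs_Sigma)
next
  case (Suc N)
  define B where "B = {x \<in> hyperbola_pairs (Suc N). fst x * snd x = Suc N}"
  have split: "hyperbola_pairs (Suc N) = hyperbola_pairs N \<union> B"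
    by (auto simp: hyperbola_pairs_def B_def)
  have disj: "hyperbola_pairs N \<inter> B = {}" by (auto simp: hyperbola_pairs_def B_def)
  have fin: "finite B" by (simp add: B_def)
  have count: "gauss_count (Suc N) = gauss_count N + (\<Sum>(d, e)\<in>B. chi4 d)"
    unfolding gauss_count_def split by (rule sum.union_disjoint) (use fin disj in auto)
  have "gauss_log_sum (Suc N) = gauss_log_sum N + (\<Sum>(d, e)\<in>B. chi4 d * ln (real (d * e)))"
    unfolding gauss_log_sum_def split by (rule sum.union_disjoint) (use fin disj in auto)
  also have "(\<Sum>(d, e)\<in>B. chi4 d * ln (real (d * e))) = (\<Sum>(d, e)\<in>B. chi4 d * ln (real (Suc N)))"
    by (intro sum.cong refl) (auto simp: B_def simp del: of_nat_mult)
  also have "\<dots> = real_of_int (gauss_count (Suc N) - gauss_count N) * ln (real (Suc N))"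
    by (simp add: count sum_distrib_right case_prod_unfold)
  also have "gauss_log_sum N \<le> gauss_count N * ln (real (Suc N))"
  proof (cases "N = 0")
    case True
    thus ?thesis by (simp add: gauss_log_sum_def hyperbola_pairs_Sigma gauss_count_eq_sum_div)
  next
    case False
    hence "gauss_count N * ln (real N) \<le> gauss_count N * ln (real (Suc N))"
      using gauss_count_nonneg[of N] by (intro mult_left_mono) auto
    with Suc.IH show ?thesis by linarith
  qed
  finally show ?case by (simp add: algebra_simps)
qed

text \<open>The range of \<open>q\<close> is made independent of \<open>m\<close> so that the sum
  can be interchanged with an outer one.\<close>

lemma sum_divisors_mangoldt:
  assumes "m \<ge> 1" "m \<le> N"
  shows "ln (real m) = (\<Sum>q=1..N. if q dvd m then mangoldt q else 0)"
proof -
  have "ln (real m) = (\<Sum>q | q dvd m. mangoldt q)"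
    using mangoldt_sum[of m, where ?'a = real] assms by simp
  also have "{q. q dvd m} = {q \<in> {1..N}. q dvd m}"
    using assms by (auto simp: Suc_le_eq intro: Nat.gr0I dest: dvd_imp_le)
  finally show ?thesis by (simp only: sum.inter_filter finite_atLeastAtMost)
qed

text \<open>Split \<open>ln (d * e)\<close> into \<open>ln d + ln e\<close> and expand both over
  prime powers. For fixed \<open>q\<close>, the pairs with \<open>q dvd d\<close> give the summand
  \<open>chi4 q\<close> and those with \<open>q dvd e\<close> the summand 1. In Dirichlet series
  this is the logarithmic derivative of \<zeta>(s) L(s, \<chi>).\<close>

lemma gauss_log_sum_eq:
  "gauss_log_sum N = (\<Sum>q=1..N. mangoldt q * (1 + chi4 q) * gauss_count (N div q))"
proof -
  let ?D = "hyperbola_pairs N"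
  have fst_sum: "(\<Sum>x\<in>?D. if q dvd fst x then chi4 (fst x) else 0) = chi4 q * gauss_count (N div q)"
    and snd_sum: "(\<Sum>x\<in>?D. if q dvd snd x then chi4 (fst x) else 0) = gauss_count (N div q)"
    if "q \<in> {1..N}" for q
  proof -
    have inj: "inj_on (\<lambda>x. (q * fst x, snd x)) A" for A :: "(nat \<times> nat) set"
      using that by (auto simp: inj_on_def)
    show "(\<Sum>x\<in>?D. if q dvd fst x then chi4 (fst x) else 0) = chi4 q * gauss_count (N div q)"
      using that
      by (simp add: sum.inter_filter [symmetric] hyperbola_pairs_dvd sum.reindex[OF inj]
                    case_prod_unfold chi4_mult gauss_count_def sum_distrib_left)
    \<comment> \<open>After swapping coordinates the divisibility concerns one entry and
      \<open>chi4\<close> the other, so no factor \<open>chi4 q\<close> arises.\<close>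
    have "(\<Sum>x\<in>?D. if q dvd snd x then chi4 (fst x) else 0) =
          (\<Sum>x\<in>?D. if q dvd fst x then chi4 (snd x) else 0)"
      by (subst hyperbola_pairs_swap, subst sum.reindex) (auto intro!: sum.cong)
    also have "\<dots> = (\<Sum>x\<in>hyperbola_pairs (N div q). chi4 (snd x))"
      using that
      by (simp add: sum.inter_filter [symmetric] hyperbola_pairs_dvd sum.reindex[OF inj]
                    case_prod_unfold)
    also have "\<dots> = gauss_count (N div q)"
      by (subst hyperbola_pairs_swap, subst sum.reindex) (auto simp: gauss_count_def case_prod_unfold)
    finally show "(\<Sum>x\<in>?D. if q dvd snd x then chi4 (fst x) else 0) = gauss_count (N div q)" .
  qed
  have "gauss_log_sum N = (\<Sum>x\<in>?D. \<Sum>q=1..N.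
          mangoldt q * of_int ((if q dvd fst x then chi4 (fst x) else 0) +
                               (if q dvd snd x then chi4 (fst x) else 0)))"
    unfolding gauss_log_sum_def
  proof (intro sum.cong refl, clarify)
    fix d e assume "(d, e) \<in> ?D"
    hence de: "d \<ge> 1" "e \<ge> 1" "d * e \<le> N" by (auto simp: hyperbola_pairs_def)
    hence le: "d \<le> N" "e \<le> N"
      by (metis dvd_triv_left dvd_triv_right dvd_imp_le le_trans mult_pos_pos less_eq_Suc_le One_nat_def)+
    have "chi4 d * ln (real (d * e)) = chi4 d * (ln (real d) + ln (real e))"
      using de by (simp add: ln_mult)
    also have "\<dots> = (\<Sum>q=1..N. mangoldt q * of_int ((if q dvd d then chi4 d else 0) +
                               (if q dvd e then chi4 d else 0)))"
      unfolding sum_divisors_mangoldt[OF de(1) le(1)] sum_divisors_mangoldt[OF de(2) le(2)]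
        sum.distrib [symmetric] sum_distrib_left
      by (intro sum.cong refl) (auto simp: algebra_simps)
    finally show "chi4 d * ln (real (d * e)) = (\<Sum>q=1..N.
          mangoldt q * of_int ((if q dvd fst (d, e) then chi4 (fst (d, e)) else 0) +
                               (if q dvd snd (d, e) then chi4 (fst (d, e)) else 0)))" by (simp only: fst_conv snd_conv)
  qed
  also have "\<dots> = (\<Sum>q=1..N. mangoldt q * of_int (
          (\<Sum>x\<in>?D. if q dvd fst x then chi4 (fst x) else 0) +
          (\<Sum>x\<in>?D. if q dvd snd x then chi4 (fst x) else 0)))"
    unfolding sum.distrib [symmetric] of_int_sum sum_distrib_left by (rule sum.swap)
  also have "\<dots> = (\<Sum>q=1..N. mangoldt q * (1 + chi4 q) * gauss_count (N div q))"
    by (intro sum.cong refl, subst fst_sum, simp, subst snd_sum, simp) (simp add: algebra_simps)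
  finally show ?thesis .
qed

section \<open>Roots of \<open>k\<^sup>2 + 1\<close> modulo prime powers\<close>

text \<open>If \<open>p\<close> were 3 modulo 4, then \<open>(p - 1) / 2\<close> would be odd, and
  raising \<open>k^2 = -1\<close> to that power would contradict Fermat's theorem.\<close>

lemma prime_dvd_square_plus_1_mod_4:
  fixes p k :: nat
  assumes "prime p" "p dvd k\<^sup>2 + 1" "p \<noteq> 2"
  shows "p mod 4 = 1"
proof (rule ccontr)
  assume "p mod 4 \<noteq> 1"
  have "odd p" using assms prime_odd_nat prime_ge_2_nat[of p] by (metis le_neq_implies_less)
  hence "p mod 4 = 3" using \<open>p mod 4 \<noteq> 1\<close> by presburger
  define t where "t = p div 4"
  have t: "p - 1 = 2 * (2 * t + 1)" unfolding t_def using \<open>p mod 4 = 3\<close> by presburger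
  have "\<not> p dvd k"
  proof
    assume "p dvd k"
    hence "p dvd k\<^sup>2" by (simp add: power2_eq_square)
    with assms(2) have "p dvd 1" by (metis dvd_add_right_iff)
    with \<open>prime p\<close> show False by simp
  qed
  hence "[k ^ (p - 1) = 1] (mod p)" using \<open>prime p\<close> by (intro fermat_theorem)
  hence "[int k ^ (p - 1) = 1] (mod int p)" by (metis cong_int_iff of_nat_1 of_nat_power)
  moreover have "int p dvd int (k\<^sup>2 + 1)" using assms(2) by (simp only: int_dvd_int_iff)
  hence "[int k ^ 2 = -1] (mod int p)" by (simp add: cong_iff_dvd_diff add.commute)
  hence "[(int k ^ 2) ^ (2 * t + 1) = (-1) ^ (2 * t + 1)] (mod int p)" by (rule cong_pow)
  hence "[int k ^ (p - 1) = -1] (mod int p)" unfolding t power_mult by simp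
  ultimately have "[-1 = 1] (mod int p)" by (metis cong_sym cong_trans)
  hence "int p dvd 2" by (simp add: cong_iff_dvd_diff)
  hence "p dvd 2" by (metis int_dvd_int_iff of_nat_numeral)
  hence "p \<le> 2" by (intro dvd_imp_le) auto
  with prime_ge_2_nat[OF \<open>prime p\<close>] \<open>p \<noteq> 2\<close> show False by simp
qed

text \<open>Blocks of length \<open>q\<close> are cut starting at 1, not 0; each contains at most
  one member of the class.\<close>

lemma card_residue_class_le:
  fixes q r n :: nat
  assumes "q > 0"
  shows "card {k \<in> {1..n}. k mod q = r} \<le> (n - 1) div q + 1"
proof -
  have "inj_on (\<lambda>k. (k - 1) div q) {k \<in> {1..n}. k mod q = r}"
  proof (rule inj_onI, clarsimp)
    fix k l assume *: "Suc 0 \<le> k" "Suc 0 \<le> l" "l mod q = k mod q" "(k - Suc 0) div q = (l - Suc 0) div q"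
    have "[(k - 1) + 1 = (l - 1) + 1] (mod q)" using * by (simp add: cong_def)
    hence "[k - 1 = l - 1] (mod q)" by (simp only: cong_add_rcancel_nat)
    hence "(k - 1) mod q = (l - 1) mod q" by (simp add: cong_def)
    with * have "k - 1 = l - 1" by (metis One_nat_def div_mult_mod_eq)
    with * show "k = l" by linarith
  qed
  moreover have "(\<lambda>k. (k - 1) div q) ` {k \<in> {1..n}. k mod q = r} \<subseteq> {..(n - 1) div q}"
    by (auto intro!: div_le_mono)
  ultimately have "card {k \<in> {1..n}. k mod q = r} \<le> card {..(n - 1) div q}"
    by (intro card_inj_on_le) auto
  thus ?thesis by simp
qed

text \<open>The power \<open>p ^ j\<close> divides \<open>(k - l) * (k + l)\<close>. If
  \<open>p\<close> divided both factors it would divide \<open>2 * k\<close>, hence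
  \<open>k\<close>, hence 1; so the whole power falls into one factor.\<close>

lemma square_plus_1_roots_mod_prime_power:
  fixes p k l :: nat
  assumes "prime p" "odd p" "j > 0" "p ^ j dvd k\<^sup>2 + 1" "p ^ j dvd l\<^sup>2 + 1"
  shows "[int k = int l] (mod int (p ^ j)) \<or> [int k = - int l] (mod int (p ^ j))"
proof -
  let ?a = "int k - int l" and ?b = "int k + int l"
  have d: "int (p ^ j) dvd int (k\<^sup>2 + 1)" "int (p ^ j) dvd int (l\<^sup>2 + 1)"
    using assms by (simp_all only: int_dvd_int_iff)
  have "int p ^ j dvd int (k\<^sup>2 + 1) - int (l\<^sup>2 + 1)" using dvd_diff[OF d] by simp
  also have "int (k\<^sup>2 + 1) - int (l\<^sup>2 + 1) = ?a * ?b" by (simp add: power2_eq_square algebra_simps)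
  finally have prod: "int p ^ j dvd ?a * ?b" .
  have pr: "prime (int p)" using assms by simp
  have "\<not> (int p dvd ?a \<and> int p dvd ?b)"
  proof
    assume *: "int p dvd ?a \<and> int p dvd ?b"
    hence "int p dvd ?a + ?b" using dvd_add by blast
    hence "int p dvd 2 * int k" by simp
    moreover have "\<not> int p dvd 2"
      using assms by (metis int_dvd_int_iff of_nat_numeral primes_dvd_imp_eq two_is_prime_nat even_numeral dvd_refl)
    ultimately have "int p dvd int k" using pr by (simp add: prime_dvd_mult_iff)
    hence "int p dvd int k ^ 2" by (simp add: power2_eq_square)
    moreover have "int p dvd int k ^ 2 + 1"
      using dvd_trans[OF dvd_power d(1)[unfolded of_nat_power]] assms(3) by (simp add: add.commute)
    ultimately have "int p dvd 1" by (metis dvd_add_right_iff)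
    with pr show False by simp
  qed
  hence "coprime (int p ^ j) ?a \<or> coprime (int p ^ j) ?b"
    using pr prime_imp_coprime by (metis coprime_power_left_iff)
  hence "int p ^ j dvd ?b \<or> int p ^ j dvd ?a"
    using prod by (metis coprime_dvd_mult_right_iff coprime_dvd_mult_left_iff)
  thus ?thesis by (auto simp: cong_iff_dvd_diff)
qed

definition roots_count :: "nat \<Rightarrow> nat \<Rightarrow> nat" where
  "roots_count n q = card {k \<in> {1..n}. q dvd k\<^sup>2 + 1}"

text \<open>Once one root \<open>a\<close> is fixed, every root lies in the class of
  \<open>a\<close> or of \<open>-a\<close>.\<close>

lemma roots_count_prime_power_le:
  assumes "prime p" "odd p" "j > 0"
  shows "roots_count n (p ^ j) \<le> 2 * ((n - 1) div p ^ j + 1)"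
proof (cases "{k \<in> {1..n}. p ^ j dvd k\<^sup>2 + 1} = {}")
  case False
  define q where "q = p ^ j"
  have "q > 0" using assms by (auto simp: q_def prime_gt_0_nat)
  from False obtain a where a: "q dvd a\<^sup>2 + 1" by (auto simp: q_def)
  define r where "r = nat ((- int a) mod int q)"
  have "{k \<in> {1..n}. q dvd k\<^sup>2 + 1} \<subseteq>
          {k \<in> {1..n}. k mod q = a mod q} \<union> {k \<in> {1..n}. k mod q = r}"
  proof
    fix k assume k: "k \<in> {k \<in> {1..n}. q dvd k\<^sup>2 + 1}"
    hence "[int k = int a] (mod int q) \<or> [int k = - int a] (mod int q)"
      using square_plus_1_roots_mod_prime_power[OF assms, of k a] a by (simp add: q_def)
    hence "k mod q = a mod q \<or> k mod q = r"
      by (auto simp: cong_int_iff cong_def r_def nat_mod_distrib simp flip: of_nat_mod)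
    with k show "k \<in> {k \<in> {1..n}. k mod q = a mod q} \<union> {k \<in> {1..n}. k mod q = r}" by blast
  qed
  hence "roots_count n q \<le> card ({k \<in> {1..n}. k mod q = a mod q} \<union> {k \<in> {1..n}. k mod q = r})"
    unfolding roots_count_def by (intro card_mono) auto
  also have "\<dots> \<le> card {k \<in> {1..n}. k mod q = a mod q} + card {k \<in> {1..n}. k mod q = r}"
    by (rule card_Un_le)
  also have "\<dots> \<le> ((n - 1) div q + 1) + ((n - 1) div q + 1)"
    using card_residue_class_le[OF \<open>q > 0\<close>] by (intro add_mono)
  finally show ?thesis by (simp add: q_def)
next
  case True
  thus ?thesis unfolding roots_count_def by (simp only: card.empty)
qed

lemma four_not_dvd_square_plus_1: "\<not> 4 dvd k\<^sup>2 + (1::nat)"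
proof (cases "even k")
  case True
  then obtain m where "k = 2 * m" by (elim evenE)
  hence "k\<^sup>2 + 1 = 4 * m\<^sup>2 + 1" by (simp add: power2_eq_square)
  thus ?thesis by presburger
next
  case False
  then obtain m where "k = 2 * m + 1" by (elim oddE)
  hence "k\<^sup>2 + 1 = 4 * (m\<^sup>2 + m) + 2" by (simp add: power2_eq_square)
  thus ?thesis by presburger
qed

lemma primepow_dvd_square_plus_1_cases:
  fixes q k :: nat
  assumes "primepow q" "q dvd k\<^sup>2 + 1"
  obtains "q = 2" | p j where "prime p" "p mod 4 = 1" "j > 0" "q = p ^ j"
proof -
  from assms(1) obtain p j where pj: "prime p" "j > 0" "q = p ^ j"
    by (auto simp: primepow_def)
  have "p dvd k\<^sup>2 + 1" using assms(2) pj by (metis dvd_power dvd_trans)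
  show ?thesis
  proof (cases "p = 2")
    case True
    have "j < 2"
    proof (rule ccontr)
      assume "\<not> j < 2"
      hence "p ^ 2 dvd q" unfolding pj(3) by (intro le_imp_power_dvd) auto
      with True assms(2) have "4 dvd k\<^sup>2 + 1" by (metis dvd_trans numeral_eq_Suc power2_eq_square mult_2 numeral_Bit0)
      thus False using four_not_dvd_square_plus_1 by blast
    qed
    with pj True have "q = 2" by (cases j) auto
    thus ?thesis by (rule that(1))
  next
    case False
    thus ?thesis using prime_dvd_square_plus_1_mod_4[OF pj(1) \<open>p dvd k\<^sup>2 + 1\<close>] pj that(2) by blast
  qed
qed

text \<open>When roots exist, \<open>1 + chi4 q\<close> bounds the number of root classes: 1 for
  \<open>q = 2\<close>, and 2 for powers of primes that are 1 modulo 4. With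
  \<open>M = 2 * n div q\<close>, each class has at most \<open>M div 2 + 1\<close> members up to
  \<open>n\<close>, and for \<open>M \<ge> 1\<close> this is at most \<open>M - M div 3\<close>, the
  lower bound for \<open>gauss_count M\<close>.\<close>

lemma roots_count_le_gauss_count:
  assumes "primepow q" "q \<le> 2 * n"
  shows "int (roots_count n q) \<le> (1 + chi4 q) * gauss_count (2 * n div q)"
proof (cases "{k \<in> {1..n}. q dvd k\<^sup>2 + 1} = {}")
  case True
  have "0 \<le> (1 + chi4 q) * gauss_count (2 * n div q)"
    using chi4_ge[of q] gauss_count_nonneg by (intro mult_nonneg_nonneg) auto
  thus ?thesis by (simp only: True roots_count_def) simp
next
  case False
  define M where "M = 2 * n div q"
  have "q > 0" using assms(1) primepow_gt_0_nat by blast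
  have "M \<ge> 1" using assms(2) \<open>q > 0\<close> by (simp add: M_def less_eq_div_iff_mult_less_eq)
  have "(n - 1) div q \<le> n div q" by (rule div_le_mono) simp
  also have "n div q = M div 2" unfolding M_def by (metis div_mult2_eq div_mult_mult1 mult.commute zero_neq_numeral)
  finally have "(n - 1) div q + 1 \<le> M div 2 + 1" by simp
  also have "\<dots> \<le> M - M div 3" using \<open>M \<ge> 1\<close> div_times_less_eq_dividend[of M 2] div_times_less_eq_dividend[of M 3]
    by linarith
  finally have le: "int ((n - 1) div q + 1) \<le> gauss_count M" using gauss_count_ge[of M] by linarith
  from False obtain k where "q dvd k\<^sup>2 + 1" by auto
  from assms(1) this show ?thesis
  proof (cases rule: primepow_dvd_square_plus_1_cases)
    case 1
    have "{k \<in> {1..n}. 2 dvd k\<^sup>2 + 1} = {k \<in> {1..n}. k mod 2 = 1}" by (auto simp: odd_iff_mod_2_eq_one)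
    hence "roots_count n q \<le> (n - 1) div q + 1"
      using card_residue_class_le[of 2 n 1] by (simp add: roots_count_def 1)
    with le 1 show ?thesis by (simp add: M_def chi4_def)
  next
    case (2 p j)
    have "odd p" using 2 by presburger
    have "chi4 q = 1" using 2 by (simp add: chi4_power) (simp add: chi4_def)
    moreover have "roots_count n q \<le> 2 * ((n - 1) div q + 1)"
      using roots_count_prime_power_le[OF \<open>prime p\<close> \<open>odd p\<close> \<open>j > 0\<close>] 2 by simp
    ultimately show ?thesis using le by (simp add: M_def)
  qed
qed

section \<open>Chebyshev-type estimates\<close>

text \<open>Expand each logarithm over the prime powers dividing its argument, then count the
  multiples of each \<open>q\<close>.\<close>

lemma sum_ln_square_plus_1:
  "(\<Sum>k=1..n. ln (real (k\<^sup>2 + 1))) = (\<Sum>q=1..n\<^sup>2+1. mangoldt q * roots_count n q)"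
proof -
  have "(\<Sum>k=1..n. ln (real (k\<^sup>2 + 1))) = (\<Sum>k=1..n. \<Sum>q=1..n\<^sup>2+1. if q dvd k\<^sup>2 + 1 then mangoldt q else 0)"
    by (intro sum.cong refl sum_divisors_mangoldt) (auto intro: power_mono)
  also have "\<dots> = (\<Sum>q=1..n\<^sup>2+1. \<Sum>k=1..n. if q dvd k\<^sup>2 + 1 then mangoldt q else 0)"
    by (rule sum.swap)
  also have "\<dots> = (\<Sum>q=1..n\<^sup>2+1. mangoldt q * roots_count n q)"
    by (intro sum.cong refl) (simp add: roots_count_def flip: sum.inter_filter)
  finally show ?thesis .
qed

text \<open>A weak Stirling bound; the induction step is
  \<open>n * ln (1 + 1/n) \<le> 1\<close>.\<close>

lemma sum_ln_ge: "(\<Sum>k=1..n. ln (real k)) \<ge> real n * ln (real n) - real n"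
proof (induction n)
  case (Suc n)
  show ?case
  proof (cases "n = 0")
    case False
    have "ln (real (Suc n) / real n) \<le> real (Suc n) / real n - 1"
      using False by (intro ln_le_minus_one) auto
    also have "\<dots> = 1 / real n" using False by (simp add: field_simps)
    finally have "ln (real (Suc n)) - ln (real n) \<le> 1 / real n" using False by (simp add: ln_div)
    hence "real n * (ln (real (Suc n)) - ln (real n)) \<le> real n * (1 / real n)"
      by (intro mult_left_mono) auto
    with Suc.IH False show ?thesis by (simp add: algebra_simps)
  qed simp
qed simp

text \<open>Apart from 5, these primes lie in 8 of the 60 residue classes modulo 60.\<close>

lemma card_primes_1_mod_4_le:
  "card {p \<in> {1..n}. prime p \<and> p mod 4 = 1} \<le> 8 * (n div 60 + 1) + 1"
proof -
  define S :: "nat set" where "S = {1, 13, 17, 29, 37, 41, 49, 53}"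
  define P where "P = {p \<in> {1..n}. prime p \<and> p mod 4 = 1} - {5}"
  have "(\<lambda>p. (p div 60, p mod 60)) ` P \<subseteq> {..n div 60} \<times> S"
  proof (rule image_subsetI, rule SigmaI)
    fix p assume p: "p \<in> P"
    thus "p div 60 \<in> {..n div 60}" by (auto simp: P_def intro: div_le_mono)
    have pr: "prime p" "p mod 4 = 1" "p \<noteq> 5" using p by (auto simp: P_def)
    have "\<not> 3 dvd p" "\<not> 5 dvd p"
      using pr primes_dvd_imp_eq[of 3 p] primes_dvd_imp_eq[of 5 p] by auto
    hence "\<not> 3 dvd p mod 60" "\<not> 5 dvd p mod 60" by (simp_all add: dvd_mod_iff)
    moreover have "p mod 60 mod 4 = 1" using pr(2) by (simp add: mod_mod_cancel)
    moreover have "\<forall>r\<in>{0..<60::nat}. r mod 4 = 1 \<longrightarrow> \<not> 3 dvd r \<longrightarrow> \<not> 5 dvd r \<longrightarrow>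
                     r \<in> {1, 13, 17, 29, 37, 41, 49, 53}"
      by code_simp
    ultimately show "p mod 60 \<in> S" unfolding S_def by simp
  qed
  moreover have "inj_on (\<lambda>p. (p div 60, p mod 60)) P"
    by (intro inj_onI) (metis Pair_inject div_mult_mod_eq)
  ultimately have "card P \<le> card ({..n div 60} \<times> S)"
    by (intro card_inj_on_le) (auto simp: S_def)
  also have "\<dots> = 8 * (n div 60 + 1)" by (simp add: card_cartesian_product S_def)
  finally have "card P \<le> 8 * (n div 60 + 1)" .
  moreover have "card {p \<in> {1..n}. prime p \<and> p mod 4 = 1} \<le> card (insert 5 P)"
    by (intro card_mono) (auto simp: P_def)
  moreover have "finite P" by (simp add: P_def)
  hence "card (insert 5 P) \<le> card P + 1" by (simp add: card_insert_if)
  ultimately show ?thesis by linarith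
qed

section \<open>Private primes\<close>

definition has_private_prime :: "nat \<Rightarrow> bool" where
  "has_private_prime n \<longleftrightarrow> (\<exists>p k. prime p \<and> k \<in> {1..n} \<and> p dvd k\<^sup>2 + 1 \<and>
      (\<forall>j\<in>{1..n}. p dvd j\<^sup>2 + 1 \<longrightarrow> j = k))"

text \<open>The prime divides the difference \<open>(k - j) * (k + j)\<close>, hence one of these
  two nonzero factors.\<close>

lemma prime_dvd_two_square_plus_1_le:
  fixes p j k :: nat
  assumes "prime p" "p dvd j\<^sup>2 + 1" "p dvd k\<^sup>2 + 1" "j \<noteq> k"
  shows "p \<le> j + k"
  using assms
proof (induction j k rule: linorder_wlog)
  case (le j k)
  hence "j < k" by simp
  have "p dvd (k\<^sup>2 + 1) - (j\<^sup>2 + 1)" using le by (intro dvd_diff_nat)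
  also have "(k\<^sup>2 + 1) - (j\<^sup>2 + 1) = (k - j) * (k + j)"
    using less_imp_add_positive[OF \<open>j < k\<close>] by (auto simp: power2_eq_square algebra_simps)
  finally have "p dvd k - j \<or> p dvd k + j" using \<open>prime p\<close> by (simp add: prime_dvd_mult_iff)
  hence "p \<le> k - j \<or> p \<le> k + j" using \<open>j < k\<close> by (auto dest: dvd_imp_le)
  thus ?case by linarith
qed (simp add: add.commute)

text \<open>The private prime is \<open>k^2 + 1\<close> itself: a second multiple at
  \<open>j \<le> n\<close> would force \<open>k^2 + 1 \<le> j + k \<le> k^2\<close>.\<close>

lemma has_private_prime_between:
  assumes "prime (k\<^sup>2 + 1)" "k \<ge> 1" "k \<le> n" "n + k \<le> k\<^sup>2"
  shows "has_private_prime n"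
proof -
  have "j = k" if j: "j \<in> {1..n}" "k\<^sup>2 + 1 dvd j\<^sup>2 + 1" for j
    using prime_dvd_two_square_plus_1_le[OF assms(1) j(2), of k] j(1) assms(4) by (cases "j = k") auto
  thus ?thesis unfolding has_private_prime_def using assms by (intro exI[of _ "k\<^sup>2 + 1"] exI[of _ k]) auto
qed

text \<open>Each pair consists of the quotient and the remainder of one modular squaring, so that a chain
  is checked by multiplications only.\<close>

fun squaring_chain :: "nat \<Rightarrow> nat \<Rightarrow> (nat \<times> nat) list \<Rightarrow> nat \<Rightarrow> bool" where
  "squaring_chain m x [] y \<longleftrightarrow> x = y"
| "squaring_chain m x ((q, r) # qs) y \<longleftrightarrow> x * x = q * m + r \<and> squaring_chain m r qs y"

lemma squaring_chain_cong:
  "squaring_chain m x qs y \<Longrightarrow> [x ^ (2 ^ length qs) = y] (mod m)"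
proof (induction m x qs y rule: squaring_chain.induct)
  case (2 m x q r qs y)
  have "x * x = q * m + r" using 2 by simp
  hence "[x ^ 2 = r] (mod m)" by (simp add: cong_def power2_eq_square)
  hence "[(x ^ 2) ^ (2 ^ length qs) = r ^ (2 ^ length qs)] (mod m)" by (rule cong_pow)
  also have "[r ^ (2 ^ length qs) = y] (mod m)" using 2 by simp
  finally show ?case by (simp flip: power_mult)
qed simp

text \<open>Proth's criterion.\<close>

lemma prime_by_squarings:
  assumes chain: "squaring_chain n (a ^ r) qs (n - 1)"
    and n: "n = 2 ^ Suc (length qs) * r + 1" "n \<le> (2 ^ Suc (length qs))\<^sup>2" "n \<ge> 2"
  shows "prime n"
proof (rule pocklington_alt[where q = "2 ^ Suc (length qs)" and r = r and a = a])
  let ?e = "2 ^ length qs * r"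
  \<comment> \<open>The chain ends at \<open>n - 1\<close>, that is at -1, with exponent
    \<open>(n - 1) / 2\<close>.\<close>
  have half: "[a ^ ?e = n - 1] (mod n)"
    using squaring_chain_cong[OF chain] by (simp add: power_mult [symmetric] mult.commute)
  have "[(a ^ ?e) ^ 2 = (n - 1) ^ 2] (mod n)" using half by (rule cong_pow)
  also have "(n - 1) ^ 2 = n * (n - 2) + 1"
  proof -
    obtain m where "n = m + 2" using n(3) by (metis add.commute le_iff_add)
    thus ?thesis by (simp add: power2_eq_square)
  qed
  also have "[n * (n - 2) + 1 = 0 + 1] (mod n)" by (intro cong_add cong_refl) (simp add: cong_def)
  also have "(a ^ ?e) ^ 2 = a ^ (n - 1)" by (simp add: n(1) mult_ac flip: power_mult)
  finally show "[a ^ (n - 1) = 1] (mod n)" by simp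
  \<comment> \<open>The only prime factor of the factored part is 2, so the single gcd condition is
    that \<open>n - 2\<close> is coprime to \<open>n\<close>, which holds as \<open>n\<close> is
    odd.\<close>
  have "coprime (n - 1 - 1) n"
  proof -
    have "odd n" by (subst n(1)) simp
    hence "coprime 2 n" by simp
    moreover have "n = (n - 1 - 1) + 2" using n(3) by simp
    ultimately show ?thesis by (metis coprime_commute coprime_iff_gcd_eq_1 gcd_add1 gcd.commute gcd_add2)
  qed
  show "\<forall>p. prime p \<and> p dvd 2 ^ Suc (length qs) \<longrightarrow>
      (\<exists>b. [a ^ ((n - 1) div p) = b] (mod n) \<and> coprime (b - 1) n)"
  proof (intro allI impI, elim conjE)
    fix p :: nat assume "prime p" "p dvd 2 ^ Suc (length qs)"
    hence "p = 2" using prime_dvd_power primes_dvd_imp_eq two_is_prime_nat by blast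
    moreover have "(n - 1) div 2 = ?e" by (simp add: n(1))
    ultimately show "\<exists>b. [a ^ ((n - 1) div p) = b] (mod n) \<and> coprime (b - 1) n"
      using half \<open>coprime (n - 1 - 1) n\<close> by metis
  qed
qed (use n in auto)

section \<open>Certified primes and the range up to \<open>7 * 10 ^ 24\<close>\<close>

lemma prime_square_plus_1_40: "prime ((40::nat)\<^sup>2 + 1)"
proof (rule prime_by_squarings)
  \<comment> \<open>Here and below \<open>k\<close> is 5 or 3 times a power of 2, so
    \<open>k^2\<close> is 25 or 9 times a large power of 2, as Proth's criterion requires. For
    \<open>k = 5 * 2^m\<close> the prime is 2 modulo 3, so the base 3 is a quadratic
    nonresidue.\<close>
  show "squaring_chain (40\<^sup>2 + 1) (3 ^ 25)
    [(448405988564555021093, 356), (79, 257), (41, 408), (103, 1561), (1521, 1600)]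
    (40\<^sup>2 + 1 - 1)"
    by simp
qed simp_all

lemma prime_square_plus_1_160: "prime ((160::nat)\<^sup>2 + 1)"
proof (rule prime_by_squarings)
  show "squaring_chain (160\<^sup>2 + 1) (3 ^ 25)
    [(28041794761605116548, 24901), (24220, 3581), (500, 23061), (20773, 148), (0, 21904), (18740,
     22476), (19732, 11644), (5295, 25441), (25281, 25600)]
    (160\<^sup>2 + 1 - 1)"
    by simp
qed simp_all

lemma prime_square_plus_1_5120: "prime ((5120::nat)\<^sup>2 + 1)"
proof (rule prime_by_squarings)
  show "squaring_chain (5120\<^sup>2 + 1) (3 ^ 25)
    [(27385633861778973, 17180076), (11259269, 18832907), (13529906, 4694343), (840639, 8359410),
     (2665700, 6802400), (1765161, 7476439), (2132306, 15582015), (9262053, 20034972), (15312198,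
     4477386), (764731, 20301865), (15722873, 24784152), (23431936, 23848768), (21696613, 21594011),
     (17787982, 17939339), (12276453, 21957268), (18391479, 12534745), (5993645, 18733380),
     (13387280, 5120), (0, 26214400)]
    (5120\<^sup>2 + 1 - 1)"
    by simp
qed simp_all

lemma prime_square_plus_1_6291456: "prime ((6291456::nat)\<^sup>2 + 1)"
proof (rule prime_by_squarings)
  \<comment> \<open>Now \<open>k = 3 * 2^21\<close> and the prime is 1 modulo 3, so 3 is a residue;
    it is 2 modulo 5, so the base 5 works.\<close>
  show "squaring_chain (6291456\<^sup>2 + 1) (5 ^ 9)
    [(0, 3814697265625), (367635827801, 13313365192088), (4477889401588, 22735433299788),
     (13058826257017, 13691018837015), (4735536721240, 4710883548345), (560663663086,
     23479963413443), (13928120145177, 10542630060400), (2807990328075, 10628843828725),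
     (2854103542212, 27171715084981), (18652273579375, 17548912270986), (7780331086065,
     35711946834291), (32219939857269, 11022021080628), (3069164366373, 21532494155883),
     (11713491013757, 5565957176380), (782667668754, 38362068635902), (37179342801149,
     21954668425991), (12177312118465, 38884658795376), (38199199117034, 28486550954518),
     (20501111705327, 28783059847925), (20930114013057, 2881649428216), (209787671417,
     3867204041927), (377826005354, 32459827810631), (26618899470117, 1404487035532), (49834848469,
     13077902576571), (4320896545784, 38263818102433), (36989143856368, 33213298670673),
     (27869019822580, 25325171095469), (16203261794007, 27269675152402), (18787007192094,
     39304831071526), (39029190236587, 34858994673657), (30699223358220, 19356109321509),
     (9465287400775, 21899021285906), (12115660190641, 19500063651219), (9606600502228,
     38764871026325), (37964209334343, 11222051269234), (3181575031130, 21178563907946),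
     (11331585715777, 999209832867), (25223832332, 38248999676605), (36960499838260,
     18290438136405), (8451735367737, 6291456), (0, 39582418599936)]
    (6291456\<^sup>2 + 1 - 1)"
    by simp
qed simp_all

lemma prime_square_plus_1_2748779069440: "prime ((2748779069440::nat)\<^sup>2 + 1)"
proof (rule prime_by_squarings)
  show "squaring_chain (2748779069440\<^sup>2 + 1) (3 ^ 25)
    [(0, 717897987691852588770249), (68209646927226536443054, 2913777334941371782944547),
     (1123655161614391535257563, 1059094121065989849220846), (148453159203313373416166,
     1093305733463542292281950), (158198944210527265080783, 3710222691798830224372917),
     (1821882163407125705921648, 3609004491626152191554441), (1723832937869383514198052,
     3896530780095213280317229), (2009446981627944763782336, 1836716264268237992286505),
     (446482532601096103660834, 1359565287391844969511791), (244636055008912622429384,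
     4369534825151248836375897), (2526915617607810142974943, 7209948988666289468654866),
     (6879940995650615344004768, 6150007245579631437428388), (5005777989949950123453413,
     566566227835483633708331), (42483637664524874224680, 1105538409962002356932881),
     (161758831659784648496855, 1621357448178166608735306), (347918779744590402171240,
     3996709430124177883878396), (2114099774814700618450228, 1300745608963462420781788),
     (223926280575537087855795, 2607744204351156875309149), (900016159799753211383836,
     2070398460909880763150765), (567320140559748422583355, 4160082500881585489373870),
     (2290467935530791621325705, 4688779591867024448363195), (2909644738085488364696186,
     853968633297688404382239), (96517078526957390637203, 5918513582200833456355118),
     (4636023478610049773285873, 4550471535873039284935251), (2740520996451738260558192,
     6377800896395803565663609), (5383469339686508226284262, 3335907898433213676857419),
     (1472815794157027996257198, 6986714603464810564991563), (6460503055954781920216418,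
     1300419841970060083481751), (223814131580514347155838, 7123819514271090071273363),
     (6716548347105280725788465, 3320976198529124640917304), (1459660499561522734532501,
     6822940692559576098182315), (6161174681043699306283414, 1681555415555234971445411),
     (374233531249684881530354, 7190502380082304826014167), (6842878018034334007643954,
     3496754293108506246685535), (1618268434735951389420907, 1480243278588493561180118),
     (289992339083948588941286, 6037629047282136964663038), (4824509682383015078606686,
     6095162196075050810453158), (4916894200612587924197392, 3684787532813331978644372),
     (1796988227622400166156916, 4560223598973649366659868), (2752279941115359510565643,
     1751836708038250256766981), (406169748626407002146848, 5141051043573803001374713),
     (3498035085865770399230619, 12546155592411264083350), (20832513306620444865,
     1964686058243591733113635), (510865595864228795069895, 6658697071832292976771330),
     (5868118089635866935094979, 5787108417503865563059521), (4432447158303882571449483,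
     6055073073218265666631158), (4852428074860744560807559, 2605438781237476850711005),
     (898425512320039274018588, 6454984836776836864094637), (5514558933821243132852612,
     5228970573646063720985957), (3618701206169600234298927, 2778974782662278350199722),
     (1022090946176946723002411, 947885782423821412185273), (118913824745029546708832,
     1622641129978926830460497), (348469915222901188012202, 2532591221123387059727607),
     (848888252926003827211769, 5977308183992239309576280), (4728589635094034781083092,
     1362721727932202472704108), (245773294294664235363920, 5141155287488176287399744),
     (3498176945016292685111083, 6325071323775355377725653), (5294819794795781024488623,
     485238267071788660814986), (31162365400502626728446, 969527302517027901186150),
     (124405739386138239889631, 1525154363962519374051269), (307856220280633536446131,
     905442557530320447782630), (108503097435491577818191, 1281938178275982321601109),
     (217497612013336195878034, 2613581317794361348289447), (904049819288488764789962,
     121118053899310975492647), (1941503141694188021603, 2075020336560311003544206),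
     (569855893856104795671022, 2356799092823941052800214), (735132213912859227670922,
     5306638049555262814435674), (3726998885402502255759075, 5070405195816034762155201),
     (3402558990155877105346446, 1153661421813086706938355), (176147737713674642794381,
     3081405865985090259830044), (1256661006903345264676760, 193326479687322652429176),
     (4946556970412877147069, 4689438855282240727653507), (2910463013777418949270422,
     7281731537455995940589427), (7017616905624024809410037, 401070398536491747975092),
     (21289308173895673590516, 6492892259616516327400348), (5579518506229170498832143,
     7555786372588683562844161), (7555786372585934783774721, 7555786372591432341913600)]
    (2748779069440\<^sup>2 + 1 - 1)"
    by simp
qed simp_all

text \<open>The prime \<open>k^2 + 1\<close> serves from \<open>k\<close> to \<open>k^2 - k\<close>.
  The cut points are these upper ends, and each next \<open>k\<close> is below the previous end, so
  the intervals overlap.\<close>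

lemma has_private_prime_small:
  assumes "n \<ge> 4" "n \<le> 7 * 10 ^ 24"
  shows "has_private_prime n"
proof -
  consider "n \<le> 12" | "12 < n" "n \<le> 90" | "90 < n" "n \<le> 1560" | "1560 < n" "n \<le> 25440"
    | "25440 < n" "n \<le> 26209280" | "26209280 < n" "n \<le> 39582412308480" | "39582412308480 < n"
    using not_le by blast
  thus ?thesis
  proof cases
    case 1
    thus ?thesis using assms by (intro has_private_prime_between[of 4]) auto
  next
    case 2
    thus ?thesis using assms by (intro has_private_prime_between[of 10]) auto
  next
    case 3
    thus ?thesis using assms by (intro has_private_prime_between[OF prime_square_plus_1_40]) auto
  next
    case 4
    thus ?thesis using assms by (intro has_private_prime_between[OF prime_square_plus_1_160]) auto
  next
    case 5
    thus ?thesis using assms by (intro has_private_prime_between[OF prime_square_plus_1_5120]) auto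
  next
    case 6
    thus ?thesis using assms by (intro has_private_prime_between[OF prime_square_plus_1_6291456]) auto
  next
    case 7
    thus ?thesis using assms by (intro has_private_prime_between[OF prime_square_plus_1_2748779069440]) auto
  qed
qed

section \<open>The range from \<open>10 ^ 24\<close> on\<close>

lemma prime_le_if_no_private_prime:
  assumes "\<not> has_private_prime n" "prime p" "k \<in> {1..n}" "p dvd k\<^sup>2 + 1"
  shows "p \<le> 2 * n"
proof -
  from assms obtain j where j: "j \<in> {1..n}" "p dvd j\<^sup>2 + 1" "j \<noteq> k"
    unfolding has_private_prime_def by blast
  thus ?thesis using prime_dvd_two_square_plus_1_le[OF assms(2) j(2) assms(4)] assms(3) by auto
qed

text \<open>The prime \<open>p\<close> itself is at most \<open>2 * n\<close>, so
  \<open>q > 2 * n\<close> forces an exponent of at least 2, and \<open>p^2 \<le> n^2 + 1\<close>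
  gives \<open>p \<le> n\<close>. As \<open>q\<close> exceeds \<open>n\<close>, each of the two root
  classes meets \<open>{1..n}\<close> at most once.\<close>

lemma large_prime_power_cases:
  assumes "\<not> has_private_prime n" "primepow q" "q > 2 * n" "q \<le> n\<^sup>2 + 1" "roots_count n q > 0" "n \<ge> 1"
  obtains p j where "prime p" "p mod 4 = 1" "j \<ge> 2" "q = p ^ j" "p \<le> n" "roots_count n q \<le> 2"
proof -
  from assms(5) obtain k where k: "k \<in> {1..n}" "q dvd k\<^sup>2 + 1"
    unfolding roots_count_def by (metis (no_types, lifting) card.empty empty_Collect_eq less_irrefl)
  have "q \<noteq> 2" using assms(3,6) by auto
  with primepow_dvd_square_plus_1_cases[OF assms(2) k(2)]
  obtain p j where pj: "prime p" "p mod 4 = 1" "j > 0" "q = p ^ j" by metis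
  have "p dvd q" using pj by simp
  hence "p \<le> 2 * n" using prime_le_if_no_private_prime[OF assms(1) pj(1) k(1)] k(2) dvd_trans by blast
  hence "j \<noteq> 1" using pj(4) assms(3) by auto
  hence "j \<ge> 2" using pj(3) by simp
  have "p\<^sup>2 \<le> q" unfolding pj(4) using \<open>j \<ge> 2\<close> prime_gt_0_nat[OF pj(1)]
    by (intro power_increasing) auto
  hence "p\<^sup>2 < (n + 1)\<^sup>2" using assms(4,6) by (simp add: power2_eq_square)
  hence "p \<le> n" using power_less_imp_less_base by fastforce
  have "odd p" using pj(2) by presburger
  hence "roots_count n q \<le> 2 * ((n - 1) div q + 1)"
    unfolding pj(4) using pj by (intro roots_count_prime_power_le)
  also have "(n - 1) div q = 0" using assms(3) by simp
  finally have "roots_count n q \<le> 2" by simp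
  with pj \<open>j \<ge> 2\<close> \<open>p \<le> n\<close> show ?thesis using that by blast
qed

text \<open>Squares of primes that are 1 modulo 4 give the main term. Higher powers have
  \<open>p\<close> of order at most \<open>n^(2/3)\<close> and exponents of logarithmic size, so
  they are negligible.\<close>

lemma card_large_prime_powers_le:
  assumes "\<not> has_private_prime n" "n \<ge> 10 ^ 24"
  shows "real (card {q \<in> {2*n<..n\<^sup>2+1}. primepow q \<and> roots_count n q > 0}) \<le>
           8 * (real n / 60 + 1) + 1 + 48 / 10000 * real n"
proof -
  define Q where "Q = {q \<in> {2*n<..n\<^sup>2+1}. primepow q \<and> roots_count n q > 0}"
  define P where "P = {p \<in> {1..n}. prime p \<and> p mod 4 = 1}"
  \<comment> \<open>The sixth root makes the bounds polynomial:
    \<open>p^3 \<le> n^2 + 1 \<le> 2 * x^12\<close> gives \<open>p \<le> 2 * x^4\<close>, and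
    \<open>n \<ge> 10 ^ 24\<close> gives \<open>x \<ge> 10000\<close>.\<close>
  define x where "x = root 6 (real n)"
  define C where "C = nat \<lfloor>2 * x ^ 4\<rfloor>"
  \<comment> \<open>A crude bound for the exponent, from \<open>ln x \<le> x - 1\<close> and
    \<open>ln 2 \<ge> 1/2\<close>. Then \<open>C * J \<le> 48 * x^5\<close>, one power of
    \<open>x\<close> below \<open>n\<close>.\<close>
  define J where "J = nat \<lfloor>24 * x\<rfloor>"
  have x6: "x ^ 6 = real n" unfolding x_def by (rule real_root_pow_pos2) auto
  have "(10000::real) ^ 6 \<le> x ^ 6" unfolding x6 using assms(2) of_nat_le_iff[of "10 ^ 24" n, where ?'a = real] by simp
  hence x: "x \<ge> 10000" using power_mono_iff[of 10000 x 6] by (simp add: x_def)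
  have n2: "real (n\<^sup>2 + 1) \<le> 2 * x ^ 12"
  proof -
    have "x ^ 12 = (real n)\<^sup>2" unfolding x6 [symmetric] by (simp flip: power_mult)
    moreover have "1 \<le> x ^ 12" using x by (intro one_le_power) simp
    ultimately show ?thesis by simp
  qed
  have p_le: "p \<le> C" if "p ^ 3 \<le> n\<^sup>2 + 1" for p
  proof -
    have "real p ^ 3 \<le> real (n\<^sup>2 + 1)" using that of_nat_le_iff[of "p ^ 3" "n\<^sup>2 + 1", where ?'a = real] by simp
    also have "\<dots> \<le> 2 * x ^ 12" by (rule n2)
    also have "\<dots> \<le> 8 * x ^ 12" using x by simp
    also have "\<dots> = (2 * x ^ 4) ^ 3" by (simp add: power_mult_distrib flip: power_mult)
    finally have "real p \<le> 2 * x ^ 4" using x by (subst (asm) power_mono_iff) auto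
    thus ?thesis unfolding C_def by linarith
  qed
  have j_le: "j \<le> J" if "2 ^ j \<le> n\<^sup>2 + 1" for j
  proof -
    have "(2::real) ^ j \<le> real (n\<^sup>2 + 1)" using that of_nat_le_iff[of "2 ^ j" "n\<^sup>2 + 1", where ?'a = real] by simp
    hence "(2::real) ^ j \<le> 2 * x ^ 12" using n2 by linarith
    hence "ln ((2::real) ^ j) \<le> ln (2 * x ^ 12)" using x by (subst ln_le_cancel_iff) auto
    hence "real j * ln 2 \<le> ln 2 + 12 * ln x" using x by (simp add: ln_mult ln_realpow)
    moreover have "ln x \<le> x - 1" "ln 2 \<le> (2::real) - 1" using x by (intro ln_le_minus_one; simp)+
    moreover have "real j * (1 / 2) \<le> real j * ln 2"
      using ln_le_minus_one[of "1 / 2 :: real"] by (intro mult_left_mono) (auto simp: ln_div)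
    ultimately have "real j \<le> 24 * x" by linarith
    thus ?thesis unfolding J_def by linarith
  qed
  have "Q \<subseteq> (\<lambda>p. p\<^sup>2) ` P \<union> (\<lambda>(p, j). p ^ j) ` ({1..C} \<times> {1..J})"
  proof
    fix q assume q: "q \<in> Q"
    obtain p j where pj: "prime p" "p mod 4 = 1" "j \<ge> 2" "q = p ^ j" "p \<le> n"
    proof (rule large_prime_power_cases[OF assms(1)])
      show "primepow q" "q > 2 * n" "q \<le> n\<^sup>2 + 1" "roots_count n q > 0" using q by (auto simp: Q_def)
      show "n \<ge> 1" using assms(2) by (rule order_trans[rotated]) simp
    qed blast
    have "p \<ge> 2" using pj(1) by (rule prime_ge_2_nat)
    show "q \<in> (\<lambda>p. p\<^sup>2) ` P \<union> (\<lambda>(p, j). p ^ j) ` ({1..C} \<times> {1..J})"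
    proof (cases "j = 2")
      case True
      thus ?thesis using pj \<open>p \<ge> 2\<close> by (auto simp: P_def)
    next
      case False
      have "p ^ 3 \<le> p ^ j" using False \<open>p \<ge> 2\<close> pj(3) by (intro power_increasing) auto
      hence "p \<le> C" using q pj(4) by (intro p_le) (auto simp: Q_def)
      have "2 ^ j \<le> p ^ j" using \<open>p \<ge> 2\<close> by (intro power_mono) auto
      hence "j \<le> J" using q pj(4) by (intro j_le) (auto simp: Q_def)
      have "(p, j) \<in> {1..C} \<times> {1..J}" using \<open>p \<le> C\<close> \<open>j \<le> J\<close> \<open>p \<ge> 2\<close> pj(3) by auto
      thus ?thesis using pj(4) by (intro UnI2 image_eqI[of _ _ "(p, j)"]) auto
    qed
  qed
  hence "card Q \<le> card ((\<lambda>p. p\<^sup>2) ` P \<union> (\<lambda>(p, j). p ^ j) ` ({1..C} \<times> {1..J}))"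
    by (intro card_mono) (auto simp: P_def)
  also have "\<dots> \<le> card ((\<lambda>p. p\<^sup>2) ` P) + card ((\<lambda>(p, j). p ^ j) ` ({1..C} \<times> {1..J}))"
    by (rule card_Un_le)
  also have "\<dots> \<le> card P + card ({1..C} \<times> {1..J})"
    by (intro add_mono card_image_le) (auto simp: P_def)
  also have "\<dots> \<le> (8 * (n div 60 + 1) + 1) + C * J"
    using card_primes_1_mod_4_le[of n] by (simp add: P_def card_cartesian_product)
  finally have "real (card Q) \<le> real (8 * (n div 60 + 1) + 1 + C * J)"
    by (simp only: of_nat_le_iff)
  also have "\<dots> = 8 * (real (n div 60) + 1) + 1 + real C * real J" by simp
  also have "real (n div 60) \<le> real n / 60" by linarith
  also have "real C * real J \<le> (2 * x ^ 4) * (24 * x)"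
    using x by (intro mult_mono) (auto simp: C_def J_def)
  also have "\<dots> = 48 * (1 * x ^ 5)" by (simp add: eval_nat_numeral)
  also have "\<dots> \<le> 48 * (x / 10000 * x ^ 5)" using x by (intro mult_left_mono mult_right_mono) auto
  also have "\<dots> = 48 / 10000 * real n" unfolding x6 [symmetric] by (simp add: eval_nat_numeral)
  finally show ?thesis unfolding Q_def by simp
qed

lemma has_private_prime_large:
  assumes "n \<ge> 10 ^ 24"
  shows "has_private_prime n"
proof (rule ccontr)
  assume no: "\<not> has_private_prime n"
  define Q where "Q = {q \<in> {2*n<..n\<^sup>2+1}. primepow q \<and> roots_count n q > 0}"
  define L where "L = ln (real n)"
  have n: "real n \<ge> 10 ^ 24" using assms of_nat_le_iff[of "10 ^ 24" n, where ?'a = real] by simp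
  hence n1: "n \<ge> 2" by (cases "n \<ge> 2") auto
  \<comment> \<open>From \<open>exp 1 \<le> 3\<close> follows \<open>ln 10 \<ge> 2\<close>, so 24
    decimal digits give 48.\<close>
  have L: "L \<ge> 48"
  proof -
    have "exp 2 = exp 1 * exp (1::real)" by (simp flip: exp_add)
    also have "\<dots> \<le> 3 * 3" using exp_le by (intro mult_mono) auto
    finally have "ln (exp 2) \<le> ln (10::real)" by (subst ln_le_cancel_iff) auto
    hence "48 \<le> 24 * ln (10::real)" by simp
    also have "\<dots> = ln (10 ^ 24)" using ln_realpow[of 10 24] by simp
    also have "\<dots> \<le> L" unfolding L_def using n by (subst ln_le_cancel_iff) auto
    finally show ?thesis .
  qed
  have "2 * (real n * L - real n) \<le> 2 * (\<Sum>k=1..n. ln (real k))"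
    using sum_ln_ge[of n] by (simp add: L_def)
  also have "\<dots> = (\<Sum>k=1..n. ln (real (k\<^sup>2)))"
    unfolding sum_distrib_left by (intro sum.cong refl) (auto simp: ln_realpow)
  also have "\<dots> \<le> (\<Sum>k=1..n. ln (real (k\<^sup>2 + 1)))"
    by (intro sum_mono, subst ln_le_cancel_iff) (auto intro: add_pos_nonneg)
  also have "\<dots> = (\<Sum>q=1..n\<^sup>2+1. mangoldt q * roots_count n q)"
    by (rule sum_ln_square_plus_1)
  \<comment> \<open>Up to \<open>2 * n\<close> the bound by \<open>gauss_count\<close> applies;
    beyond it only the prime powers in \<open>Q\<close> contribute.\<close>
  also have "{1..n\<^sup>2+1} = {1..2*n} \<union> {2*n<..n\<^sup>2+1}"
  proof -
    have "2 * n \<le> n\<^sup>2" using n1 by (simp add: power2_eq_square)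
    thus ?thesis using n1 by auto
  qed
  also have "(\<Sum>q\<in>\<dots>. mangoldt q * roots_count n q) =
      (\<Sum>q=1..2*n. mangoldt q * roots_count n q) + (\<Sum>q\<in>{2*n<..n\<^sup>2+1}. mangoldt q * roots_count n q)"
    by (rule sum.union_disjoint) auto
  also have "(\<Sum>q=1..2*n. mangoldt q * real (roots_count n q)) \<le>
               (\<Sum>q=1..2*n. mangoldt q * (1 + chi4 q) * gauss_count (2 * n div q))"
  proof (rule sum_mono)
    fix q assume q: "q \<in> {1..2*n}"
    show "mangoldt q * real (roots_count n q) \<le> mangoldt q * (1 + chi4 q) * gauss_count (2 * n div q)"
    proof (cases "primepow q")
      case True
      have "real_of_int (int (roots_count n q)) \<le> real_of_int ((1 + chi4 q) * gauss_count (2 * n div q))"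
        using roots_count_le_gauss_count[OF True] q by (simp only: of_int_le_iff) simp
      thus ?thesis unfolding mult.assoc by (intro mult_left_mono mangoldt_nonneg) simp
    qed (simp add: mangoldt_def)
  qed
  also have "\<dots> = gauss_log_sum (2 * n)" by (rule gauss_log_sum_eq [symmetric])
  also have "\<dots> \<le> gauss_count (2 * n) * ln (real (2 * n))" by (rule gauss_log_sum_le)
  also have "\<dots> \<le> (36979 / 45045 * real (2 * n) + 3) * (L + 1)"
  proof (rule mult_mono)
    show "ln (real (2 * n)) \<le> L + 1"
      using n1 ln_le_minus_one[of 2] by (simp add: ln_mult L_def)
  qed (use gauss_count_le[of "2 * n"] gauss_count_nonneg[of "2 * n"] n1 in auto)
  also have "(\<Sum>q\<in>{2*n<..n\<^sup>2+1}. mangoldt q * real (roots_count n q)) =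
               (\<Sum>q\<in>Q. mangoldt q * real (roots_count n q))"
    by (intro sum.mono_neutral_right) (auto simp: Q_def mangoldt_def)
  also have "\<dots> \<le> (\<Sum>q\<in>Q. L * 2)"
  proof (rule sum_mono)
    fix q assume q: "q \<in> Q"
    obtain p j where pj: "prime p" "j \<ge> 2" "q = p ^ j" "p \<le> n" "roots_count n q \<le> 2"
    proof (rule large_prime_power_cases[OF no])
      show "primepow q" "q > 2 * n" "q \<le> n\<^sup>2 + 1" "roots_count n q > 0" using q by (auto simp: Q_def)
      show "n \<ge> 1" using n1 by simp
    qed blast
    have "mangoldt q = ln (real p)" using pj by simp
    also have "\<dots> \<le> L" unfolding L_def using pj prime_gt_0_nat[of p] by (subst ln_le_cancel_iff) auto
    finally show "mangoldt q * real (roots_count n q) \<le> L * 2"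
      using pj(5) L by (intro mult_mono) auto
  qed
  also have "\<dots> = real (card Q) * (L * 2)" by simp
  also have "\<dots> \<le> (8 * (real n / 60 + 1) + 1 + 48 / 10000 * real n) * (L * 2)"
    using card_large_prime_powers_le[OF no assms] L unfolding Q_def by (intro mult_right_mono) auto
  finally have main: "2 * (real n * L - real n) \<le> (36979 / 45045 * real (2 * n) + 3) * (L + 1) +
      (8 * (real n / 60 + 1) + 1 + 48 / 10000 * real n) * (L * 2)" by simp
  \<comment> \<open>The coefficient of \<open>y\<close> is 2 on the left and 73958/45045 + 4/15 +
    96/10000, below 1.919, on the right. The gap absorbs the terms in \<open>n\<close> because
    \<open>L \<ge> 48\<close>, and those in \<open>L\<close> because
    \<open>n \<ge> 10000\<close>.\<close>
  define y where "y = real n * L"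
  have "real n * 48 \<le> y" unfolding y_def using L by (intro mult_left_mono) auto
  moreover have "10000 * L \<le> y" unfolding y_def using L n by (intro mult_right_mono) auto
  moreover have "2 * (y - real n) \<le> 73958 / 45045 * y + 73958 / 45045 * real n + 3 * L + 3 +
      (4 / 15 * y + 18 * L + 96 / 10000 * y)"
    using main unfolding y_def by (simp add: field_simps)
  ultimately show False using L by simp
qed

lemma has_private_prime_ge_4: "n \<ge> 4 \<Longrightarrow> has_private_prime n"
  using has_private_prime_small[of n] has_private_prime_large[of n] by (cases "n \<le> 7 * 10 ^ 24") auto

section \<open>Reciprocal power sums\<close>

text \<open>Multiply by the product \<open>M\<close> of the other denominators. An integral sum
  would make \<open>a k ^ s k\<close> divide \<open>M\<close>, so \<open>p\<close> would divide
  another \<open>a j\<close>.\<close>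

lemma sum_recip_not_Ints:
  fixes a :: "'a \<Rightarrow> int" and p :: int
  assumes "finite A" "k \<in> A" "prime p" "p dvd a k" "s k > 0"
    and nz: "\<And>j. j \<in> A \<Longrightarrow> a j \<noteq> 0"
    and uniq: "\<And>j. j \<in> A \<Longrightarrow> p dvd a j \<Longrightarrow> j = k"
  shows "(\<Sum>j\<in>A. 1 / real_of_int (a j) ^ s j) \<notin> \<int>"
proof
  assume "(\<Sum>j\<in>A. 1 / real_of_int (a j) ^ s j) \<in> \<int>"
  then obtain z where z: "(\<Sum>j\<in>A. 1 / real_of_int (a j) ^ s j) = real_of_int z" by (elim Ints_cases)
  define B where "B = A - {k}"
  define M where "M = (\<Prod>j\<in>B. a j ^ s j)"
  have B: "finite B" "A = insert k B" "k \<notin> B" using \<open>finite A\<close> \<open>k \<in> A\<close> by (auto simp: B_def)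
  have "real_of_int M * (1 / real_of_int (a j) ^ s j) = of_int (\<Prod>i\<in>B-{j}. a i ^ s i)" if "j \<in> B" for j
  proof -
    have "M = a j ^ s j * (\<Prod>i\<in>B-{j}. a i ^ s i)"
      unfolding M_def using B(1) that by (rule prod.remove)
    moreover have "a j \<noteq> 0" using that B(2) by (intro nz) auto
    ultimately show ?thesis by (simp del: of_int_prod)
  qed
  hence "real_of_int M * (\<Sum>j\<in>B. 1 / real_of_int (a j) ^ s j) = of_int (\<Sum>j\<in>B. \<Prod>i\<in>B-{j}. a i ^ s i)"
    by (simp add: sum_distrib_left)
  then obtain w where w: "real_of_int M * (\<Sum>j\<in>B. 1 / real_of_int (a j) ^ s j) = of_int w" by blast
  have "real_of_int M * z = M * (1 / real_of_int (a k) ^ s k + (\<Sum>j\<in>B. 1 / real_of_int (a j) ^ s j))"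
    using z B by simp
  also have "\<dots> = M * (1 / real_of_int (a k) ^ s k) + of_int w"
    by (simp only: distrib_left w)
  finally have "real_of_int M * z = M * (1 / real_of_int (a k) ^ s k) + of_int w" .
  hence "real_of_int (M * z * a k ^ s k) = real_of_int (M + w * a k ^ s k)"
    using nz[OF \<open>k \<in> A\<close>] by (simp add: distrib_right)
  hence "M * z * a k ^ s k = M + w * a k ^ s k" by (simp only: of_int_eq_iff)
  hence "M = (M * z - w) * a k ^ s k" by (simp add: left_diff_distrib)
  hence "a k ^ s k dvd M" by (rule dvdI[OF trans[OF _ mult.commute]])
  moreover have "p dvd a k ^ s k" using \<open>s k > 0\<close> by (intro dvd_trans[OF \<open>p dvd a k\<close> dvd_power]) auto
  ultimately have "p dvd M" by (rule dvd_trans[rotated])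
  then obtain j where j: "j \<in> B" "p dvd a j ^ s j"
    using \<open>prime p\<close> B by (auto simp: M_def prime_dvd_prod_iff)
  with \<open>prime p\<close> have "p dvd a j" using prime_dvd_power by blast
  with uniq[of j] j B show False by auto
qed

section \<open>Telescoping comparison sums\<close>

lemma sum_telescope_pronic: "(\<Sum>k=1..n. 1 / (real k ^ 2 + real k)) = 1 - 1 / (real n + 1)"
proof (induction n)
  case (Suc n)
  have "1 / (real (Suc n) ^ 2 + real (Suc n)) = 1 / (real n + 1) - 1 / (real (Suc n) + 1)"
    by (simp add: divide_simps add_nonneg_eq_0_iff power2_eq_square algebra_simps)
  with Suc.IH show ?case by simp
qed simp

lemma sum_recip_squares_le: "n \<ge> 1 \<Longrightarrow> (\<Sum>k=1..n. 1 / real k ^ 2) \<le> 2 - 1 / real n"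
proof (induction n rule: nat_induct_at_least)
  case (Suc n)
  have "1 / real (Suc n) ^ 2 \<le> 1 / real n - 1 / real (Suc n)"
    using Suc.hyps by (simp add: divide_simps power2_eq_square)
  with Suc.IH show ?case by simp
qed simp

text \<open>The first two terms add up to exactly 1/2, which starts the induction at 2; later terms
  lie below \<open>1 / ((k - 1) * k)\<close>.\<close>

lemma sum_recip_square_plus_2_le: "n \<ge> 2 \<Longrightarrow> (\<Sum>k=1..n. 1 / (real k ^ 2 + 2)) \<le> 1 - 1 / real n"
proof (induction n rule: nat_induct_at_least)
  case base
  show ?case by (simp add: numeral_2_eq_2)
next
  case (Suc n)
  have "1 / (real (Suc n) ^ 2 + 2) \<le> 1 / (real n * (real n + 1))"
    using Suc.hyps by (intro divide_left_mono mult_pos_pos)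
                         (auto simp: power2_eq_square algebra_simps intro: add_pos_nonneg)
  also have "\<dots> = 1 / real n - 1 / real (Suc n)"
    using Suc.hyps by (simp add: divide_simps)
  finally show ?case using Suc.IH by simp
qed

section \<open>Bounds for the polynomial and the case distinction\<close>

text \<open>In \<open>f(k) - f(1)\<close> every coefficient is multiplied by some
  \<open>k^i - 1 \<ge> 0\<close>; only the leading term is kept, and its coefficient is at least
  1.\<close>

lemma poly_ge_monomial_plus:
  fixes f :: "int poly" and k :: int
  assumes nonneg: "\<forall>i. coeff f i \<ge> 0" and "f \<noteq> 0" "k \<ge> 1"
  shows "poly f k \<ge> k ^ degree f + (poly f 1 - 1)"
proof -
  let ?d = "degree f"
  have "lead_coeff f \<ge> 1" using nonneg \<open>f \<noteq> 0\<close> by (metis leading_coeff_0_iff int_one_le_iff_zero_less order_le_less)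
  hence "1 * (k ^ ?d - 1) \<le> lead_coeff f * (k ^ ?d - 1)"
    using \<open>k \<ge> 1\<close> by (intro mult_right_mono) auto
  also have "\<dots> = (\<Sum>i\<in>{?d}. coeff f i * (k ^ i - 1))" by simp
  also have "\<dots> \<le> (\<Sum>i\<le>?d. coeff f i * (k ^ i - 1))"
    using nonneg \<open>k \<ge> 1\<close> by (intro sum_mono2) auto
  also have "\<dots> = poly f k - poly f 1"
    by (simp add: poly_altdef right_diff_distrib sum_subtractf)
  finally show ?thesis by simp
qed

lemma recip_power_sum_pos:
  assumes "n \<ge> 1" "\<And>k. k \<ge> 1 \<Longrightarrow> poly f (int k) \<ge> 1"
  shows "recip_power_sum f s n > 0"
  unfolding recip_power_sum_def
proof (rule sum_pos)
  fix k assume "k \<in> {1..n}"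
  hence "poly f (int k) \<ge> 1" using assms(2) by simp
  thus "0 < 1 / real_of_int (poly f (int k)) ^ s k" by simp
qed (use assms(1) in auto)

text \<open>The bases are at least 1, so larger exponents only shrink the terms and the worst case
  is exponent 1 throughout.\<close>

lemma recip_power_sum_le:
  fixes g :: "nat \<Rightarrow> int"
  assumes "\<And>k. k \<ge> 1 \<Longrightarrow> g k \<ge> 1 \<and> poly f (int k) \<ge> g k" "\<forall>i\<ge>1. s i > 0"
  shows "recip_power_sum f s n \<le> (\<Sum>k=1..n. 1 / real_of_int (g k))"
  unfolding recip_power_sum_def
proof (rule sum_mono)
  fix k assume k: "k \<in> {1..n}"
  have g: "real_of_int (g k) \<ge> 1" "real_of_int (g k) \<le> real_of_int (poly f (int k))"
    using assms(1)[of k] k by auto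
  have "real_of_int (poly f (int k)) ^ 1 \<le> real_of_int (poly f (int k)) ^ s k"
    using g assms(2) k by (intro power_increasing) (auto simp: Suc_le_eq)
  thus "1 / real_of_int (poly f (int k)) ^ s k \<le> 1 / real_of_int (g k)"
    using g by (intro divide_left_mono mult_pos_pos zero_less_power) auto
qed

text \<open>With all exponents 1 the full series exceeds 1, so size alone cannot decide; private
  primes do from \<open>n = 4\<close> on. For \<open>n = 2\<close> and \<open>n = 3\<close> the sum
  is at most 7/10 and 8/10.\<close>

lemma recip_power_sum_not_Ints_square_plus_1:
  assumes f: "\<And>k. poly f (int k) = int (k\<^sup>2 + 1)" and s: "\<forall>i\<ge>1. s i > 0" and "n \<ge> 2"
  shows "recip_power_sum f s n \<notin> \<int>"
proof (cases "n \<ge> 4")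
  case True
  then obtain p k where pk: "prime p" "k \<in> {1..n}" "p dvd k\<^sup>2 + 1"
    "\<forall>j\<in>{1..n}. p dvd j\<^sup>2 + 1 \<longrightarrow> j = k"
    using has_private_prime_ge_4 unfolding has_private_prime_def by blast
  show ?thesis unfolding recip_power_sum_def
  proof (rule sum_recip_not_Ints[where p = "int p" and k = k])
    show "int p dvd poly f (int k)" unfolding f using pk(3) by (simp only: int_dvd_int_iff)
    show "j = k" if "j \<in> {1..n}" "int p dvd poly f (int j)" for j
      using pk(4) that unfolding f by (simp only: int_dvd_int_iff)
    show "poly f (int j) \<noteq> 0" for j unfolding f of_nat_eq_0_iff by simp
  qed (use pk(1,2) s in auto)
next
  case False
  have "recip_power_sum f s n \<le> (\<Sum>k=1..n. 1 / real_of_int (int (k\<^sup>2 + 1)))"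
    using s by (intro recip_power_sum_le) (auto simp: f)
  also have "n = 2 \<or> n = 3" using False \<open>n \<ge> 2\<close> by auto
  hence "(\<Sum>k=1..n. 1 / real_of_int (int (k\<^sup>2 + 1))) < 1" by (auto simp: eval_nat_numeral)
  finally have "recip_power_sum f s n < 1" .
  moreover have "recip_power_sum f s n > 0"
    using \<open>n \<ge> 2\<close> by (intro recip_power_sum_pos) (auto simp: f)
  ultimately show ?thesis by (auto elim!: Ints_cases)
qed

theorem theorem1p1:
  fixes f :: "int poly" and s :: "nat \<Rightarrow> nat" and n :: nat
  assumes "\<forall>i. coeff f i \<ge> 0"
    and "degree f \<ge> 2"
    and "\<forall>i\<ge>1. s i > 0"
    and "n \<ge> 2"
  shows "recip_power_sum f s n \<notin> \<int>"
proof -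
  let ?H = "recip_power_sum f s n"
  have "f \<noteq> 0" using assms(2) by auto
  have nonneg: "coeff f i \<ge> 0" for i using assms(1) by blast
  have lower: "poly f (int k) \<ge> int k ^ degree f + (poly f 1 - 1)" if "k \<ge> 1" for k :: nat
    using that \<open>f \<noteq> 0\<close> assms(1) by (intro poly_ge_monomial_plus) auto
  have power_le: "int k ^ m \<le> int k ^ degree f" if "k \<ge> 1" "m \<le> degree f" for k m
    using that by (intro power_increasing) auto
  have "lead_coeff f \<le> poly f 1"
    unfolding poly_altdef by (simp add: member_le_sum nonneg)
  moreover have "lead_coeff f \<noteq> 0" using \<open>f \<noteq> 0\<close> by simp
  ultimately have f1: "poly f 1 \<ge> 1" using nonneg[of "degree f"] by linarith
  have f_ge_1: "poly f (int k) \<ge> 1" if "k \<ge> 1" for k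
    using lower[OF that] f1 power_le[OF that, of 0] by simp
  have pos: "?H > 0" using assms(4) f_ge_1 by (intro recip_power_sum_pos) auto
  have less_1: "?H \<notin> \<int>" if "?H < 1" using that pos by (auto elim!: Ints_cases)
  \<comment> \<open>The bound \<open>lower\<close> yields \<open>k^2\<close>, \<open>k^2 + 1\<close>
    and \<open>k^2 + 2\<close> in the three cases. In the first, the term at \<open>k = 1\<close>
    equals 1, so the sum exceeds 1; the second needs a sharper bound than
    \<open>k^2 + 1\<close>.\<close>
  consider "poly f 1 = 1" | "poly f 1 = 2" | "poly f 1 \<ge> 3" using f1 by linarith
  thus ?thesis
  proof cases
    case 1
    have "?H \<le> (\<Sum>k=1..n. 1 / real_of_int (int k ^ 2))"
    proof (rule recip_power_sum_le)
      fix k :: nat assume "k \<ge> 1"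
      thus "int k ^ 2 \<ge> 1 \<and> int k ^ 2 \<le> poly f (int k)"
        using lower[of k] power_le[of k 2] assms(2) 1 one_le_power[of "int k" 2] by simp
    qed (use assms in auto)
    also have "\<dots> \<le> 2 - 1 / real n" using sum_recip_squares_le[of n] assms(4) by simp
    also have "\<dots> < 2" using assms(4) by simp
    finally have "?H < 2" .
    moreover have "?H > 1"
    proof -
      have "?H = 1 + (\<Sum>k=2..n. 1 / real_of_int (poly f (int k)) ^ s k)"
        unfolding recip_power_sum_def using assms(4) 1 by (simp add: sum.atLeast_Suc_atMost numeral_2_eq_2)
      moreover have "(\<Sum>k=2..n. 1 / real_of_int (poly f (int k)) ^ s k) > 0"
      proof (rule sum_pos)
        fix k assume "k \<in> {2..n}"
        hence "poly f (int k) \<ge> 1" by (intro f_ge_1) simp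
        thus "1 / real_of_int (poly f (int k)) ^ s k > 0" by simp
      qed (use assms(4) in auto)
      ultimately show ?thesis by linarith
    qed
    ultimately show ?thesis by (auto elim!: Ints_cases)
  next
    case 2
    \<comment> \<open>The sum of \<open>1 / (k^2 + k)\<close> telescopes to less than 1, so this
      growth suffices.\<close>
    have pronic: ?thesis if "\<And>k. k \<ge> 1 \<Longrightarrow> poly f (int k) \<ge> int k ^ 2 + int k"
    proof (rule less_1)
      have "?H \<le> (\<Sum>k=1..n. 1 / real_of_int (int k ^ 2 + int k))"
      proof (rule recip_power_sum_le)
        fix k :: nat assume "k \<ge> 1"
        thus "int k ^ 2 + int k \<ge> 1 \<and> int k ^ 2 + int k \<le> poly f (int k)"
          using that[of k] zero_le_power2[of "int k"] by linarith
      qed (use assms in auto)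
      also have "\<dots> < 1" using sum_telescope_pronic[of n] by simp
      finally show "?H < 1" .
    qed
    show ?thesis
    proof (cases "degree f = 2")
      case False
      show ?thesis
      proof (rule pronic)
        fix k :: nat assume k: "k \<ge> 1"
        \<comment> \<open>The product expands to \<open>k^3 - k^2 - k + 1\<close>.\<close>
        have "0 \<le> (int k - 1)\<^sup>2 * (int k + 1)" by simp
        hence "int k ^ 2 + int k \<le> int k ^ 3 + 1"
          by (simp add: power2_eq_square power3_eq_cube algebra_simps)
        thus "int k ^ 2 + int k \<le> poly f (int k)"
          using lower[OF k] power_le[OF k, of 3] False assms(2) 2 by simp
      qed
    next
      case True
      have f: "poly f x = coeff f 0 + coeff f 1 * x + coeff f 2 * x\<^sup>2" for x
        by (simp add: poly_altdef True eval_nat_numeral)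
      have sum2: "coeff f 0 + coeff f 1 + coeff f 2 = 2" using 2 f[of 1] by simp
      have "coeff f 2 \<noteq> 0" using True \<open>f \<noteq> 0\<close> by (metis leading_coeff_0_iff)
      \<comment> \<open>The coefficients sum to 2 and the leading one is nonzero, leaving
        \<open>2x^2\<close>, \<open>x^2 + x\<close> and \<open>x^2 + 1\<close>; the first two
        dominate \<open>k^2 + k\<close>.\<close>
      then consider "coeff f 2 = 2" "coeff f 1 = 0" "coeff f 0 = 0" | "coeff f 2 = 1" "coeff f 1 = 1" "coeff f 0 = 0"
        | "coeff f 2 = 1" "coeff f 1 = 0" "coeff f 0 = 1"
        using sum2 nonneg[of 0] nonneg[of 1] nonneg[of 2] by linarith
      thus ?thesis
      proof cases
        case 1
        show ?thesis by (rule pronic) (simp add: f 1 power2_eq_square del: One_nat_def)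
      next
        case 2
        show ?thesis by (rule pronic) (simp add: f 2 del: One_nat_def)
      next
        case 3
        thus ?thesis using assms(3,4) by (intro recip_power_sum_not_Ints_square_plus_1) (simp_all add: f del: One_nat_def)
      qed
    qed
  next
    case 3
    show ?thesis
    proof (rule less_1)
      have "?H \<le> (\<Sum>k=1..n. 1 / real_of_int (int k ^ 2 + 2))"
      proof (rule recip_power_sum_le)
        fix k :: nat assume "k \<ge> 1"
        thus "int k ^ 2 + 2 \<ge> 1 \<and> int k ^ 2 + 2 \<le> poly f (int k)"
          using lower[of k] power_le[of k 2] assms(2) 3 by simp
      qed (use assms in auto)
      also have "\<dots> \<le> 1 - 1 / real n" using sum_recip_square_plus_2_le[of n] assms(4) by simp
      also have "\<dots> < 1" using assms(4) by simp
      finally show "?H < 1" .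
    qed
  qed
qed

end
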